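(* Let $F:\mathbb R^d\to\mathbb R$ be $L_1$-smooth w.r.t. $\|\cdot\|_1$. Let $x^1,\dots,x^T\in\Delta_d$ be deterministic vectors and $a^1,\dots,a^T\in\Delta_d$ be random vectors such that $\mathbb E[a^t\mid a^{t-1},\dots,a^1]=x^t$ for all $t\in[T]$. Let $\bar x^T=\frac1T\sum_{t=1}^Tx^t$ and $\bar a^T=\frac1T\sum_{t=1}^Ta^t$. Then $$\big|\mathbb E[F(\bar a^T)-F(\bar x^T)]\big|\le\frac{2L_1}{T}.$$
   Context: $\Delta_d=\{x\in\mathbb R^d:x_j\ge0,\ \sum_jx_j=1\}$. A differentiable $F$ is $L_1$-smooth w.r.t. $\|\cdot\|_1$ if $\|\nabla F(u)-\nabla F(u')\|_\infty\le L_1\|u-u'\|_1$ for all $u,u'$. *)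

theory Defs
  imports "HOL-Probability.Probability"
begin

definition prob_simplex :: "(real ^ 'd::finite) set" where
  "prob_simplex = {x. (\<forall>j. 0 \<le> x $ j) \<and> (\<Sum>j\<in>UNIV. x $ j) = 1}"

definition l1_norm :: "real ^ 'd::finite \<Rightarrow> real" where
  "l1_norm v = (\<Sum>j\<in>UNIV. \<bar>v $ j\<bar>)"

(* The gradient is taken for the standard inner product; its existence at every
   point is the differentiability of F, and it is unique where it exists.
   The library's infnorm is the sup-norm over the standard basis. *)
definition l1_smooth :: "real \<Rightarrow> (real ^ 'd::finite \<Rightarrow> real) \<Rightarrow> bool" where
  "l1_smooth L F \<longleftrightarrow>
    (\<exists>gradF. (\<forall>u. GDERIV F u :> gradF u) \<and>
      (\<forall>u u'. infnorm (gradF u - gradF u') \<le> L * l1_norm (u - u')))"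

(* The sigma-algebra on the space of M generated by a 1, ..., a (t - 1); only its
   space and sets matter. For t = 1 it is the trivial one. (A supremum of vimage
   algebras would have empty space in that case.) *)
definition past_algebra ::
  "'w measure \<Rightarrow> (nat \<Rightarrow> 'w \<Rightarrow> real ^ 'd::finite) \<Rightarrow> nat \<Rightarrow> 'w measure" where
  "past_algebra M a t =
    sigma (space M) (\<Union>s\<in>{1..<t}. {a s -` B \<inter> space M | B. B \<in> sets borel})"

(* The library has conditional expectation only for real-valued functions. *)
definition vec_cond_exp ::
  "'w measure \<Rightarrow> 'w measure \<Rightarrow> ('w \<Rightarrow> real ^ 'd::finite) \<Rightarrow> 'w \<Rightarrow> real ^ 'd" where
  "vec_cond_exp M G X \<omega> = (\<chi> j. real_cond_exp M G (\<lambda>\<omega>'. X \<omega>' $ j) \<omega>)"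

end

theory Submission
  imports Defs
begin

text \<open>Replace the points \<open>x t\<close> by \<open>a t\<close> one at a time, so that the average moves from that of \<open>x\<close> to
  that of \<open>a\<close>. In step \<open>t\<close>, the first-order term of \<open>F\<close> is the inner product of a gradient depending
  only on \<open>a s\<close> for \<open>s < t\<close> with the martingale difference \<open>(a t - x t) / T\<close>, so it has mean zero. The
  remainder is at most \<open>L/2 \<cdot> (2/T)\<^sup>2\<close>, since two points of the simplex have \<open>l1\<close>-distance at most 2,
  and there are \<open>T\<close> steps.\<close>

lemma l1_norm_nonneg: "0 \<le> l1_norm v"
  by (simp add: l1_norm_def sum_nonneg)

lemma l1_norm_scaleR: "l1_norm (c *\<^sub>R v) = \<bar>c\<bar> * l1_norm v"
  by (simp add: l1_norm_def abs_mult sum_distrib_left)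

lemma l1_norm_diff_triangle: "l1_norm (u - v) \<le> l1_norm u + l1_norm v"
  unfolding l1_norm_def sum.distrib[symmetric] by (rule sum_mono) (simp add: abs_triangle_ineq4)

lemma l1_norm_prob_simplex: "v \<in> prob_simplex \<Longrightarrow> l1_norm v = 1"
  by (simp add: l1_norm_def prob_simplex_def)

lemma norm_prob_simplex_le: "v \<in> prob_simplex \<Longrightarrow> norm v \<le> 1"
  using norm_le_l1_cart[of v] l1_norm_prob_simplex[of v] by (simp add: l1_norm_def)

text \<open>Hoelder's inequality for the dual pair of sup-norm and l1-norm: every
  \<open>u $ j\<close> is at most \<open>infnorm u\<close> in absolute value, so that factor comes
  out of the sum.\<close>

lemma abs_inner_le_infnorm_l1_norm:
  fixes u v :: "real ^ 'd::finite"
  shows "\<bar>u \<bullet> v\<bar> \<le> infnorm u * l1_norm v"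
proof -
  have "\<bar>u \<bullet> v\<bar> \<le> (\<Sum>j\<in>UNIV. \<bar>u $ j * v $ j\<bar>)"
    by (simp add: inner_vec_def sum_abs)
  also have "\<dots> \<le> (\<Sum>j\<in>UNIV. infnorm u * \<bar>v $ j\<bar>)"
    by (intro sum_mono) (simp add: abs_mult component_le_infnorm_cart mult_right_mono)
  finally show ?thesis
    by (simp add: l1_norm_def sum_distrib_left)
qed

text \<open>Serves to make the gradient at a random point measurable and integrable. In finite
  dimension the norms are equivalent: the Euclidean norm is at most the square root of the dimension
  times the sup-norm, and the l1-distance to \<open>u\<close> tends to 0 at
  \<open>u\<close>.\<close>

lemma gradient_lipschitz_imp_continuous:
  fixes g :: "real ^ 'd::finite \<Rightarrow> real ^ 'd"
  assumes "\<And>u u'. infnorm (g u - g u') \<le> L * l1_norm (u - u')"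
  shows "continuous_on UNIV g"
proof -
  have "(g \<longlongrightarrow> g u) (at u)" for u
  proof -
    have bound: "norm (g v - g u) \<le> sqrt DIM(real ^ 'd) * (L * l1_norm (v - u))" for v
      using norm_le_infnorm[of "g v - g u"] assms[of v u]
      by (meson mult_left_mono order_trans real_sqrt_ge_zero of_nat_0_le_iff)
    have "((\<lambda>v. sqrt DIM(real ^ 'd) * (L * l1_norm (v - u))) \<longlongrightarrow> 0) (at u)"
      unfolding l1_norm_def by (auto intro!: tendsto_eq_intros)
    then have "((\<lambda>v. g v - g u) \<longlongrightarrow> 0) (at u)"
      by (rule Lim_null_comparison[OF always_eventually, rotated]) (rule allI, rule bound)
    then show ?thesis
      by (rule LIM_zero_cancel)
  qed
  then show ?thesis
    by (simp add: continuous_on_eq_continuous_at isCont_def)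
qed

text \<open>Restrict \<open>F\<close> to the ray from \<open>y\<close> in direction \<open>d\<close>
  and subtract both the linear term and the claimed quadratic bound. The resulting
  \<open>\<phi>\<close> is nonincreasing on [0, 1], and the claim is
  \<open>\<phi> 1 \<le> \<phi> 0\<close>. Working with the sign of a derivative avoids integrating
  the gradient.\<close>

lemma smooth_upper_bound:
  fixes F :: "real ^ 'd::finite \<Rightarrow> real"
  assumes grad: "\<And>u. GDERIV F u :> g u"
    and lip: "\<And>u u'. infnorm (g u - g u') \<le> L * l1_norm (u - u')"
  shows "F (y + d) - F y - g y \<bullet> d \<le> L / 2 * (l1_norm d)\<^sup>2"
proof -
  define \<phi> where "\<phi> s = F (y + s *\<^sub>R d) - s * (g y \<bullet> d) - L / 2 * (l1_norm d)\<^sup>2 * s\<^sup>2" for s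
  have "(\<phi> has_real_derivative (g (y + s *\<^sub>R d) - g y) \<bullet> d - L * (l1_norm d)\<^sup>2 * s) (at s)" for s
  proof -
    have "((\<lambda>s. F (y + s *\<^sub>R d)) has_derivative (\<lambda>h. (h *\<^sub>R d) \<bullet> g (y + s *\<^sub>R d))) (at s)"
      using grad[of "y + s *\<^sub>R d"] unfolding gderiv_def
      by (rule has_derivative_compose[rotated]) (auto intro!: derivative_eq_intros)
    then have "((\<lambda>s. F (y + s *\<^sub>R d)) has_real_derivative g (y + s *\<^sub>R d) \<bullet> d) (at s)"
      by (simp add: has_field_derivative_def inner_commute mult.commute[of _ "_ \<bullet> _"])
    then show ?thesis
      unfolding \<phi>_def by (auto intro!: derivative_eq_intros simp: inner_diff_left)
  qed
  \<comment> \<open>Hoelder and the Lipschitz bound give \<open>L * \<bar>s\<bar>\<close> times the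
    squared l1-norm of \<open>d\<close>; for \<open>s \<ge> 0\<close> this is exactly the derivative
    of the subtracted quadratic.\<close>
  moreover have "(g (y + s *\<^sub>R d) - g y) \<bullet> d - L * (l1_norm d)\<^sup>2 * s \<le> 0" if "0 \<le> s" for s
  proof -
    have "(g (y + s *\<^sub>R d) - g y) \<bullet> d \<le> infnorm (g (y + s *\<^sub>R d) - g y) * l1_norm d"
      using abs_inner_le_infnorm_l1_norm abs_le_D1 by blast
    also have "\<dots> \<le> L * l1_norm (s *\<^sub>R d) * l1_norm d"
      using lip[of "y + s *\<^sub>R d" y] by (intro mult_right_mono l1_norm_nonneg) simp
    finally show ?thesis
      using that by (simp add: l1_norm_scaleR power2_eq_square mult_ac)
  qed
  ultimately have "\<phi> 1 \<le> \<phi> 0"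
    by (intro DERIV_nonpos_imp_nonincreasing[of 0 1 \<phi>]) (auto intro!: exI)
  then show ?thesis
    by (simp add: \<phi>_def)
qed

text \<open>The lower bound is the upper bound for \<open>- F\<close>, whose gradient
  \<open>- g\<close> satisfies the same Lipschitz estimate.\<close>

lemma smooth_remainder_bound:
  fixes F :: "real ^ 'd::finite \<Rightarrow> real"
  assumes grad: "\<And>u. GDERIV F u :> g u"
    and lip: "\<And>u u'. infnorm (g u - g u') \<le> L * l1_norm (u - u')"
  shows "\<bar>F (y + d) - F y - g y \<bullet> d\<bar> \<le> L / 2 * (l1_norm d)\<^sup>2"
proof -
  have "GDERIV (\<lambda>u. - F u) u :> - g u" for u
    using grad by (rule GDERIV_minus)
  moreover have "infnorm (- g u - - g u') \<le> L * l1_norm (u - u')" for u u'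
    using lip[of u u'] infnorm_neg[of "g u - g u'"] by simp
  ultimately have "- F (y + d) - - F y - - g y \<bullet> d \<le> L / 2 * (l1_norm d)\<^sup>2"
    by (rule smooth_upper_bound)
  with smooth_upper_bound[OF grad lip, of y d] show ?thesis
    unfolding inner_minus_left by linarith
qed

text \<open>The values of \<open>Y\<close> lie in a compact ball, on which \<open>f\<close> is
  bounded; no global bound on \<open>f\<close> is required.\<close>

lemma (in finite_measure) integrable_continuous_bounded:
  fixes Y :: "'a \<Rightarrow> 'b::euclidean_space" and f :: "'b \<Rightarrow> 'c::euclidean_space"
  assumes "continuous_on UNIV f" "Y \<in> borel_measurable M" "\<And>\<omega>. \<omega> \<in> space M \<Longrightarrow> norm (Y \<omega>) \<le> B"
  shows "integrable M (\<lambda>\<omega>. f (Y \<omega>))"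
proof -
  have "bounded (f ` cball 0 B)"
    by (intro compact_imp_bounded compact_continuous_image compact_cball
        continuous_on_subset[OF assms(1)]) auto
  then obtain C where "\<forall>z\<in>cball 0 B. norm (f z) \<le> C"
    unfolding bounded_iff by blast
  moreover have "(\<lambda>\<omega>. f (Y \<omega>)) \<in> borel_measurable M"
    using assms(1,2) borel_measurable_continuous_on by blast
  ultimately show ?thesis
    using assms(3) by (intro integrable_const_bound[where B = C]) (auto intro!: AE_I2)
qed

text \<open>In each coordinate the \<open>G\<close>-measurable factor \<open>h \<omega> $ j\<close>
  can be pulled out of the conditional expectation. Boundedness of \<open>X\<close> makes the
  products integrable although \<open>h\<close> is merely integrable.\<close>

lemma (in prob_space) expectation_inner_cond_exp:
  fixes h X :: "'a \<Rightarrow> real ^ 'd::finite"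
  assumes sub: "subalgebra M G"
    and h: "h \<in> borel_measurable G" "integrable M h"
    and X: "X \<in> borel_measurable M" "\<And>\<omega>. \<omega> \<in> space M \<Longrightarrow> norm (X \<omega>) \<le> B"
    and ce: "AE \<omega> in M. vec_cond_exp M G X \<omega> = c"
  shows "expectation (\<lambda>\<omega>. h \<omega> \<bullet> X \<omega>) = expectation (\<lambda>\<omega>. h \<omega> \<bullet> c)"
proof -
  interpret finite_measure_subalgebra M G
    by standard (rule sub)
  have hj: "integrable M (\<lambda>\<omega>. h \<omega> $ j)" for j
    using integrable_inner_left[OF h(2), of "axis j 1"] by (simp add: inner_axis)
  have hG: "(\<lambda>\<omega>. h \<omega> $ j) \<in> borel_measurable G" for j
    using h(1) borel_measurable_continuous_on[OF continuous_on_component[OF continuous_on_id]] by blast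
  have Xj: "(\<lambda>\<omega>. X \<omega> $ j) \<in> borel_measurable M" for j
    using X(1) borel_measurable_continuous_on[OF continuous_on_component[OF continuous_on_id]] by blast
  have hX: "integrable M (\<lambda>\<omega>. h \<omega> $ j * X \<omega> $ j)" for j
  proof (rule Bochner_Integration.integrable_bound)
    show "integrable M (\<lambda>\<omega>. B * h \<omega> $ j)"
      using hj by simp
    show "(\<lambda>\<omega>. h \<omega> $ j * X \<omega> $ j) \<in> borel_measurable M"
      using hj Xj by measurable
    have "norm (h \<omega> $ j * X \<omega> $ j) \<le> norm (B * h \<omega> $ j)" if "\<omega> \<in> space M" for \<omega>
    proof -
      have "\<bar>X \<omega> $ j\<bar> \<le> \<bar>B\<bar>"
        using component_le_norm_cart[of "X \<omega>" j] X(2)[OF that] by linarith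
      then show ?thesis
        by (simp add: abs_mult mult.commute[of "\<bar>B\<bar>"] mult_left_mono)
    qed
    then show "AE \<omega> in M. norm (h \<omega> $ j * X \<omega> $ j) \<le> norm (B * h \<omega> $ j)"
      by (rule AE_I2)
  qed
  have "expectation (\<lambda>\<omega>. h \<omega> $ j * X \<omega> $ j) = expectation (\<lambda>\<omega>. h \<omega> $ j * c $ j)" for j
  proof -
    have "expectation (\<lambda>\<omega>. h \<omega> $ j * X \<omega> $ j)
        = expectation (\<lambda>\<omega>. h \<omega> $ j * real_cond_exp M G (\<lambda>\<omega>. X \<omega> $ j) \<omega>)"
      using real_cond_exp_intg(2)[OF hX hG Xj] by simp
    also have "\<dots> = expectation (\<lambda>\<omega>. h \<omega> $ j * c $ j)"
    proof (rule integral_cong_AE)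
      show "AE \<omega> in M. h \<omega> $ j * real_cond_exp M G (\<lambda>\<omega>. X \<omega> $ j) \<omega> = h \<omega> $ j * c $ j"
        using ce by eventually_elim (auto simp: vec_cond_exp_def)
    qed (use hj in measurable)
    finally show ?thesis .
  qed
  then show ?thesis
    using hX hj by (simp add: inner_vec_def Bochner_Integration.integral_sum)
qed

lemma subalgebra_past_algebra:
  assumes "\<And>s. s \<in> {1..<t} \<Longrightarrow> a s \<in> borel_measurable M"
  shows "subalgebra M (past_algebra M a t)"
proof -
  let ?A = "\<Union>s\<in>{1..<t}. {a s -` B \<inter> space M | B. B \<in> sets borel}"
  have A: "?A \<subseteq> sets M"
    using assms by (auto intro: measurable_sets)
  have "?A \<subseteq> Pow (space M)"
    by auto
  then have "sets (past_algebra M a t) = sigma_sets (space M) ?A"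
    "space (past_algebra M a t) = space M"
    by (simp_all add: past_algebra_def)
  with sets.sigma_sets_subset[OF A] show ?thesis
    unfolding subalgebra_def by simp
qed

lemma measurable_past_algebra:
  assumes "s \<in> {1..<t}"
  shows "a s \<in> borel_measurable (past_algebra M a t)"
proof (rule measurableI)
  let ?A = "\<Union>s\<in>{1..<t}. {a s -` B \<inter> space M | B. B \<in> sets borel}"
  have "?A \<subseteq> Pow (space M)"
    by auto
  then have *: "sets (past_algebra M a t) = sigma_sets (space M) ?A"
    "space (past_algebra M a t) = space M"
    by (simp_all add: past_algebra_def)
  fix B :: "(real ^ 'b) set" assume "B \<in> sets borel"
  then show "a s -` B \<inter> space (past_algebra M a t) \<in> sets (past_algebra M a t)"
    unfolding * using assms by (intro sigma_sets.Basic UN_I[of s]) auto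
qed simp

theorem corollary2p2:
  fixes F :: "real ^ 'd::finite \<Rightarrow> real"
    and L\<^sub>1 :: real
    and T :: nat
    and M :: "'w measure"
    and x :: "nat \<Rightarrow> real ^ 'd"
    and a :: "nat \<Rightarrow> 'w \<Rightarrow> real ^ 'd"
  assumes "l1_smooth L\<^sub>1 F"
    and "T \<ge> 1"
    and "prob_space M"
    and "\<And>t. t \<in> {1..T} \<Longrightarrow> x t \<in> prob_simplex"
    and "\<And>t. t \<in> {1..T} \<Longrightarrow> a t \<in> borel_measurable M"
    and "\<And>t \<omega>. t \<in> {1..T} \<Longrightarrow> \<omega> \<in> space M \<Longrightarrow> a t \<omega> \<in> prob_simplex"
    and "\<And>t. t \<in> {1..T} \<Longrightarrow>
           AE \<omega> in M. vec_cond_exp M (past_algebra M a t) (a t) \<omega> = x t"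
  shows "\<bar>prob_space.expectation M
            (\<lambda>\<omega>. F ((1 / real T) *\<^sub>R (\<Sum>t=1..T. a t \<omega>))
                - F ((1 / real T) *\<^sub>R (\<Sum>t=1..T. x t)))\<bar>
         \<le> 2 * L\<^sub>1 / real T"
proof -
  interpret prob_space M by fact
  from assms(1) obtain g where grad: "\<And>u. GDERIV F u :> g u"
    and lip: "\<And>u u'. infnorm (g u - g u') \<le> L\<^sub>1 * l1_norm (u - u')"
    unfolding l1_smooth_def by blast
  have T: "real T > 0"
    using assms(2) by simp
  \<comment> \<open>The sign of \<open>L\<^sub>1\<close> follows from the Lipschitz bound at
    \<open>x 1\<close> and 0, two points at l1-distance exactly 1.\<close>
  have L: "0 \<le> L\<^sub>1"
  proof -
    have "0 \<le> L\<^sub>1 * l1_norm (x 1 - 0)"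
      using lip[of "x 1" 0] infnorm_pos_le order_trans by blast
    then show ?thesis
      using assms(2) assms(4)[of 1] by (simp add: l1_norm_prob_simplex)
  qed
  have contF: "continuous_on UNIV F"
    using grad unfolding gderiv_def by (intro has_derivative_continuous_on) auto
  have contg: "continuous_on UNIV g"
    using lip by (rule gradient_lipschitz_imp_continuous)
  \<comment> \<open>The hybrid averages. As \<open>s\<close> starts at 1, \<open>Y 0\<close> is the
    average of the \<open>x s\<close>, while \<open>Y T\<close> is that of the
    \<open>a s\<close>.\<close>
  define Y where "Y t \<omega> = (1 / real T) *\<^sub>R (\<Sum>s=1..T. if s \<le> t then a s \<omega> else x s)" for t \<omega>
  have Y_bound: "norm (Y t \<omega>) \<le> 1" if "\<omega> \<in> space M" for t \<omega>
  proof -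
    have "norm (\<Sum>s=1..T. if s \<le> t then a s \<omega> else x s) \<le> real (card {1..T}) * 1"
      using that assms(4,6) by (intro sum_norm_bound) (auto intro!: norm_prob_simplex_le)
    then show ?thesis
      using T by (simp add: Y_def field_simps)
  qed
  have Y_meas: "Y t \<in> borel_measurable M" for t
  proof -
    have "(\<lambda>\<omega>. if s \<le> t then a s \<omega> else x s) \<in> borel_measurable M" if "s \<in> {1..T}" for s
      using assms(5)[OF that] by (cases "s \<le> t") simp_all
    then show ?thesis
      unfolding Y_def by (intro borel_measurable_scaleR borel_measurable_sum) auto
  qed
  \<comment> \<open>Only \<open>a s\<close> with \<open>s < t\<close> occur, next to constants. For
    \<open>t = 0\<close> the truncated subtraction does no harm, since no \<open>s \<ge> 1\<close>
    satisfies \<open>s \<le> 0\<close>.\<close>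
  have Y_past: "Y (t - 1) \<in> borel_measurable (past_algebra M a t)" for t
  proof -
    have "(\<lambda>\<omega>. if s \<le> t - 1 then a s \<omega> else x s) \<in> borel_measurable (past_algebra M a t)"
      if "s \<in> {1..T}" for s
      using that by (cases "s \<le> t - 1") (auto intro!: measurable_past_algebra)
    then show ?thesis
      unfolding Y_def by (intro borel_measurable_scaleR borel_measurable_sum) auto
  qed
  have Y_step: "Y t \<omega> = Y (t - 1) \<omega> + (1 / real T) *\<^sub>R (a t \<omega> - x t)" if "t \<in> {1..T}" for t \<omega>
  proof -
    have "(\<Sum>s=1..T. if s \<le> t then a s \<omega> else x s)
        = (\<Sum>s=1..T. (if s \<le> t - 1 then a s \<omega> else x s) + (if s = t then a t \<omega> - x t else 0))"
      using that by (intro sum.cong) auto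
    also have "\<dots> = (\<Sum>s=1..T. if s \<le> t - 1 then a s \<omega> else x s) + (a t \<omega> - x t)"
      using that by (simp add: sum.distrib)
    finally show ?thesis
      unfolding Y_def by (simp only: scaleR_right_distrib)
  qed
  have FY: "integrable M (\<lambda>\<omega>. F (Y t \<omega>))" for t
    using contF Y_meas Y_bound by (rule integrable_continuous_bounded)
  have gY: "integrable M (\<lambda>\<omega>. g (Y t \<omega>))" for t
    using contg Y_meas Y_bound by (rule integrable_continuous_bounded)
  have step: "\<bar>expectation (\<lambda>\<omega>. F (Y t \<omega>) - F (Y (t - 1) \<omega>))\<bar> \<le> 2 * L\<^sub>1 / (real T)\<^sup>2"
    if t: "t \<in> {1..T}" for t
  proof -
    let ?d = "\<lambda>\<omega>. (1 / real T) *\<^sub>R (a t \<omega> - x t)"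
    let ?R = "\<lambda>\<omega>. F (Y t \<omega>) - F (Y (t - 1) \<omega>) - g (Y (t - 1) \<omega>) \<bullet> ?d \<omega>"
    \<comment> \<open>The displacement has l1-norm at most 2/T, and \<open>L\<^sub>1 / 2\<close>
      times the square of 2/T is the stated constant.\<close>
    have R: "\<bar>?R \<omega>\<bar> \<le> 2 * L\<^sub>1 / (real T)\<^sup>2" if "\<omega> \<in> space M" for \<omega>
    proof -
      have "l1_norm (a t \<omega> - x t) \<le> 2"
        using l1_norm_diff_triangle[of "a t \<omega>" "x t"] assms(4)[OF t] assms(6)[OF t that]
        by (simp add: l1_norm_prob_simplex)
      then have "l1_norm (?d \<omega>) \<le> 2 / real T"
        using T unfolding l1_norm_scaleR by (simp add: divide_right_mono)
      then have "L\<^sub>1 / 2 * (l1_norm (?d \<omega>))\<^sup>2 \<le> L\<^sub>1 / 2 * (2 / real T)\<^sup>2"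
        using L by (intro mult_left_mono power_mono l1_norm_nonneg) auto
      with smooth_remainder_bound[OF grad lip, of "Y (t - 1) \<omega>" "?d \<omega>"] show ?thesis
        unfolding Y_step[OF t] by (simp add: power_divide)
    qed
    have gpast: "(\<lambda>\<omega>. g (Y (t - 1) \<omega>)) \<in> borel_measurable (past_algebra M a t)"
      using contg Y_past borel_measurable_continuous_on by blast
    \<comment> \<open>Here the martingale hypothesis enters: the gradient at
      \<open>Y (t - 1)\<close> is determined by the past, so under the expectation
      \<open>a t\<close> may be replaced by its conditional mean \<open>x t\<close>.\<close>
    have eq: "expectation (\<lambda>\<omega>. g (Y (t - 1) \<omega>) \<bullet> a t \<omega>) = expectation (\<lambda>\<omega>. g (Y (t - 1) \<omega>) \<bullet> x t)"
      using t assms(5-7)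
      by (intro expectation_inner_cond_exp[OF subalgebra_past_algebra gpast gY, where B = 1])
         (auto intro: norm_prob_simplex_le)
    \<comment> \<open>Cauchy-Schwarz with Euclidean norm of \<open>a t \<omega>\<close> at most 1
      lets the norm of the gradient dominate.\<close>
    have inta: "integrable M (\<lambda>\<omega>. g (Y (t - 1) \<omega>) \<bullet> a t \<omega>)"
    proof (rule Bochner_Integration.integrable_bound[OF gY[of "t - 1"]])
      show "(\<lambda>\<omega>. g (Y (t - 1) \<omega>) \<bullet> a t \<omega>) \<in> borel_measurable M"
        using gY[of "t - 1"] assms(5)[OF t] by measurable
      have "norm (g (Y (t - 1) \<omega>) \<bullet> a t \<omega>) \<le> norm (g (Y (t - 1) \<omega>))" if "\<omega> \<in> space M" for \<omega>
        using Cauchy_Schwarz_ineq2[of "g (Y (t - 1) \<omega>)" "a t \<omega>"]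
          norm_prob_simplex_le[OF assms(6)[OF t that]]
          mult_left_le[of "norm (a t \<omega>)" "norm (g (Y (t - 1) \<omega>))"] by simp
      then show "AE \<omega> in M. norm (g (Y (t - 1) \<omega>) \<bullet> a t \<omega>) \<le> norm (g (Y (t - 1) \<omega>))"
        by (rule AE_I2)
    qed
    have intx: "integrable M (\<lambda>\<omega>. g (Y (t - 1) \<omega>) \<bullet> x t)"
      using gY by simp
    have int_d: "integrable M (\<lambda>\<omega>. g (Y (t - 1) \<omega>) \<bullet> ?d \<omega>)"
      using inta intx by (simp add: inner_diff_right)
    have "expectation (\<lambda>\<omega>. g (Y (t - 1) \<omega>) \<bullet> ?d \<omega>) = 0"
      using eq inta intx by (simp add: inner_diff_right)
    \<comment> \<open>The linear term is removed before absolute values are taken; it is only of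
      order 1/T, whereas the remainder is of order 1/T^2.\<close>
    then have "expectation (\<lambda>\<omega>. F (Y t \<omega>) - F (Y (t - 1) \<omega>)) = expectation ?R"
      using FY int_d by simp
    also have "\<bar>\<dots>\<bar> \<le> expectation (\<lambda>\<omega>. \<bar>?R \<omega>\<bar>)"
      by (rule integral_abs_bound)
    also have "\<dots> \<le> 2 * L\<^sub>1 / (real T)\<^sup>2"
      using FY int_d R by (intro integral_le_const) (auto intro!: AE_I2)
    finally show ?thesis .
  qed
  \<comment> \<open>The increments telescope from \<open>Y 0\<close> to \<open>Y T\<close>,
    pointwise in \<open>\<omega>\<close>.\<close>
  have "F ((1 / real T) *\<^sub>R (\<Sum>t=1..T. a t \<omega>)) - F ((1 / real T) *\<^sub>R (\<Sum>t=1..T. x t))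
      = (\<Sum>t=1..T. F (Y t \<omega>) - F (Y (t - 1) \<omega>))" for \<omega>
  proof -
    have "Y T \<omega> = (1 / real T) *\<^sub>R (\<Sum>t=1..T. a t \<omega>)" "Y 0 \<omega> = (1 / real T) *\<^sub>R (\<Sum>t=1..T. x t)"
      unfolding Y_def by (auto intro!: arg_cong[where f = "scaleR _"] sum.cong)
    then show ?thesis
      using sum_telescope''[of 0 T "\<lambda>t. F (Y t \<omega>)"] by (simp add: atLeastSucAtMost_greaterThanAtMost)
  qed
  then have "\<bar>expectation (\<lambda>\<omega>. F ((1 / real T) *\<^sub>R (\<Sum>t=1..T. a t \<omega>))
                - F ((1 / real T) *\<^sub>R (\<Sum>t=1..T. x t)))\<bar>
      = \<bar>\<Sum>t=1..T. expectation (\<lambda>\<omega>. F (Y t \<omega>) - F (Y (t - 1) \<omega>))\<bar>"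
    using FY by (simp add: Bochner_Integration.integral_sum)
  also have "\<dots> \<le> (\<Sum>t=1..T. 2 * L\<^sub>1 / (real T)\<^sup>2)"
    using step by (intro order_trans[OF sum_abs] sum_mono)
  also have "\<dots> = 2 * L\<^sub>1 / real T"
    using T by (simp add: power2_eq_square)
  finally show ?thesis .
qed

end
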